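(* Let $n$ be a positive even integer. There are no continuous inverse ambiguous functions on $SL_n(\mathbb{R})$, the multiplicative group of real $n \times n$ matrices with determinant $1$.
   Context: For a group $G$, a function $f : G \to G$ is called inverse ambiguous if it is bijective and its inverse function satisfies $f^{-1}(x) = (f(x))^{-1}$ for all $x \in G$, where the right-hand side is the group inverse of $f(x)$. Equivalently, $f(f(x)) = x^{-1}$ for all $x \in G$. $SL_n(\mathbb{R})$ has the subspace topology from the space of real $n \times n$ matrices. *)

theory Defs
  imports "HOL-Analysis.Analysis" "HOL-Algebra.Group"
begin

definition inverse_ambiguous :: "('a, 'b) monoid_scheme \<Rightarrow> ('a \<Rightarrow> 'a) \<Rightarrow> bool" where
  "inverse_ambiguous G f \<longleftrightarrow>
     bij_betw f (carrier G) (carrier G) \<and>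
     (\<forall>x\<in>carrier G. inv_into (carrier G) f x = inv\<^bsub>G\<^esub> (f x))"

definition special_linear :: "(real ^ 'n ^ 'n) monoid" where
  "special_linear = \<lparr>carrier = {A. det A = 1}, mult = (**), one = mat 1\<rparr>"

lemma group_special_linear: "group (special_linear :: (real ^ 'n ^ 'n) monoid)"
proof (rule groupI)
  fix A :: "real ^ 'n ^ 'n" assume "A \<in> carrier special_linear"
  then have dA: "det A = 1" by (simp add: special_linear_def)
  then have "invertible A" by (simp add: invertible_det_nz)
  then obtain B where B: "A ** B = mat 1" "B ** A = mat 1"
    unfolding invertible_def by blast
  then have "det B * det A = 1" by (metis det_I det_mul)
  with dA B show "\<exists>B\<in>carrier special_linear. B \<otimes>\<^bsub>special_linear\<^esub> A = \<one>\<^bsub>special_linear\<^esub>"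
    by (intro bexI[of _ B]) (simp_all add: special_linear_def)
qed (simp_all add: special_linear_def det_mul matrix_mul_assoc)

lemma inverse_ambiguous_iff:
  assumes "group G" and f: "f \<in> carrier G \<rightarrow> carrier G"
  shows "inverse_ambiguous G f \<longleftrightarrow> (\<forall>x\<in>carrier G. f (f x) = inv\<^bsub>G\<^esub> x)"
proof -
  interpret group G by fact
  show ?thesis
  proof
    assume L: "inverse_ambiguous G f"
    show "\<forall>x\<in>carrier G. f (f x) = inv\<^bsub>G\<^esub> x"
    proof
      fix x assume x: "x \<in> carrier G"
      have "inv_into (carrier G) f (f x) = x"
        using L x by (simp add: inverse_ambiguous_def bij_betw_def)
      moreover have "inv_into (carrier G) f (f x) = inv\<^bsub>G\<^esub> (f (f x))"
        using L f x by (auto simp: inverse_ambiguous_def)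
      moreover have "f (f x) \<in> carrier G" using f x by blast
      ultimately show "f (f x) = inv\<^bsub>G\<^esub> x" by (metis inv_inv)
    qed
  next
    assume R: "\<forall>x\<in>carrier G. f (f x) = inv\<^bsub>G\<^esub> x"
    have inj: "inj_on f (carrier G)"
      using R by (intro inj_onI) (metis inv_inv)
    have fin: "f (inv\<^bsub>G\<^esub> (f x)) = x" if "x \<in> carrier G" for x
    proof -
      have m: "f x \<in> carrier G" using f that by blast
      then have "f (inv\<^bsub>G\<^esub> (f x)) = f (f (f (f x)))" using R by simp
      also have "\<dots> = inv\<^bsub>G\<^esub> (inv\<^bsub>G\<^esub> x)" using R that by simp
      finally show ?thesis using that by simp
    qed
    have mem: "inv\<^bsub>G\<^esub> (f x) \<in> carrier G" if "x \<in> carrier G" for x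
      using f that by blast
    have "bij_betw f (carrier G) (carrier G)"
      unfolding bij_betw_def using inj f fin mem by (metis funcset_image image_eqI subsetI subset_antisym)
    moreover have "inv_into (carrier G) f x = inv\<^bsub>G\<^esub> (f x)" if "x \<in> carrier G" for x
      using inv_into_f_eq[OF inj mem[OF that] fin[OF that]] .
    ultimately show "inverse_ambiguous G f" by (simp add: inverse_ambiguous_def)
  qed
qed

end

(*
  Extend f homogeneously to a continuous injective self-map F of the open set U of matrices with
  positive determinant; then F (F A) = det A ^ (2/n) * A^-1. Local degrees of injective maps on
  U are multiplicative under composition and constant along paths. Since f 1 = 1 or f 1 = -1,
  and 1 and -1 are joined in U by cos t + (sin t) J with J^2 = -1 (here n is even), the local
  degree of F o F at 1 is a square. On the other hand the derivative of F o F at 1 is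
  x |-> (2/n) tr(x) 1 - x, the negative of the reflection in the hyperplane orthogonal to 1;
  rotating by J again, its degree is that of the reflection, which is -1.
*)

theory Submission
  imports Defs "HOL-Homology.Brouwer_Degree"
begin

section \<open>The degree of maps between spheres of a Euclidean space\<close>

text \<open>Inversion has derivative -1 on the trace-zero matrices, the tangent space of SL_n at 1,
  whose dimension n^2 - 1 is odd for even n. So it reverses orientation, which f o f should not do.
  Two obstacles shape the proof: f is merely continuous, so orientation has to be read off from
  degrees of increments on small spheres, and SL_n is not open in a Euclidean space. The homogeneous
  extension deals with the second. It adds the radial direction, along which F o F is the identity:
  F (F (c 1)) = c 1 for c > 0. The local degree therefore stays (-1)^(n^2 - 1). The plain inverse
  A^-1 on U would have derivative -1 in the even dimension n^2, hence local degree 1 and no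
  contradiction. As F may move 1, multiplicativity yields the local degrees at 1 and at F 1; the
  path between these points makes the two factors equal. Locating f 1 makes that path explicit.
  Algebra gives only that f 1 is an involution of determinant 1, and for n >= 4 there are such
  involutions besides 1 and -1; continuity of f excludes them.\<close>

definition basis_seq :: "nat \<Rightarrow> 'a::euclidean_space" where
  "basis_seq = (SOME b. bij_betw b {..<DIM('a)} Basis)"

text \<open>\<open>Brouwer_degree2\<close> concerns \<open>nsphere\<close>, whose points are real
  sequences. Numbering the orthonormal basis identifies the unit sphere of the space with
  it.\<close>

definition of_coords :: "(nat \<Rightarrow> real) \<Rightarrow> 'a::euclidean_space" where
  "of_coords x = (\<Sum>i<DIM('a). x i *\<^sub>R basis_seq i)"

text \<open>The value 0 from the dimension on is what \<open>nsphere\<close> demands of its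
  points.\<close>

definition coords :: "'a::euclidean_space \<Rightarrow> nat \<Rightarrow> real" where
  "coords v = (\<lambda>i. if i < DIM('a) then v \<bullet> basis_seq i else 0)"

text \<open>Because of \<open>sgn\<close>, a map only has to be continuous and nonzero on the unit
  sphere to have a meaningful degree. \<open>nsphere p\<close> lives in p + 1 coordinates, whence
  \<open>DIM('a) - Suc 0\<close>.\<close>

definition sphere_degree :: "('a::euclidean_space \<Rightarrow> 'a) \<Rightarrow> int" where
  "sphere_degree \<phi> = Brouwer_degree2 (DIM('a) - Suc 0) (\<lambda>x. coords (sgn (\<phi> (of_coords x))))"

lemma bij_betw_basis_seq: "bij_betw (basis_seq :: nat \<Rightarrow> 'a::euclidean_space) {..<DIM('a)} Basis"
proof -
  have "\<exists>b. bij_betw b {..<DIM('a)} (Basis :: 'a set)"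
    using ex_bij_betw_nat_finite[OF finite_Basis] by (simp add: atLeast0LessThan)
  then show ?thesis
    unfolding basis_seq_def by (rule someI_ex)
qed

lemma basis_seq_in_Basis: "i < DIM('a) \<Longrightarrow> (basis_seq i :: 'a::euclidean_space) \<in> Basis"
  using bij_betw_basis_seq bij_betwE by blast

lemma inner_basis_seq:
  assumes "i < DIM('a)" "j < DIM('a)"
  shows "(basis_seq i :: 'a::euclidean_space) \<bullet> basis_seq j = (if i = j then 1 else 0)"
proof -
  have "(basis_seq i :: 'a) = basis_seq j \<longleftrightarrow> i = j"
    using bij_betw_basis_seq[where 'a='a] assms
    by (auto simp: bij_betw_def inj_on_def)
  then show ?thesis
    using assms by (simp add: inner_Basis basis_seq_in_Basis)
qed

lemma of_coords_coords: "of_coords (coords v) = (v :: 'a::euclidean_space)"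
proof -
  have "(of_coords (coords v) :: 'a) = (\<Sum>i<DIM('a). (v \<bullet> basis_seq i) *\<^sub>R basis_seq i)"
    by (simp add: of_coords_def coords_def)
  also have "\<dots> = (\<Sum>b\<in>Basis. (v \<bullet> b) *\<^sub>R b)"
    by (rule sum.reindex_bij_betw[OF bij_betw_basis_seq])
  finally show ?thesis
    by (simp add: euclidean_representation)
qed

lemma of_coords_inner_basis_seq:
  assumes "j < DIM('a)"
  shows "(of_coords x :: 'a::euclidean_space) \<bullet> basis_seq j = x j"
proof -
  have "(of_coords x :: 'a) \<bullet> basis_seq j = (\<Sum>i<DIM('a). x i * (if i = j then 1 else 0))"
    unfolding of_coords_def inner_sum_left inner_scaleR_left
    by (rule sum.cong) (use assms in \<open>auto simp: inner_basis_seq\<close>)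
  then show ?thesis
    using assms by (simp add: if_distrib cong: if_cong)
qed

lemma coords_of_coords:
  assumes "\<And>i. i \<ge> DIM('a) \<Longrightarrow> x i = 0"
  shows "coords (of_coords x :: 'a::euclidean_space) = x"
  using assms by (fastforce simp: coords_def of_coords_inner_basis_seq)

lemma sum_coords_power2: "(\<Sum>i<DIM('a). (coords (v::'a::euclidean_space) i)\<^sup>2) = (norm v)\<^sup>2"
proof -
  have "(\<Sum>i<DIM('a). (coords v i)\<^sup>2) = (\<Sum>i<DIM('a). (v \<bullet> basis_seq i)\<^sup>2)"
    by (simp add: coords_def)
  also have "\<dots> = (\<Sum>b\<in>Basis. (v \<bullet> b)\<^sup>2)"
    by (rule sum.reindex_bij_betw[OF bij_betw_basis_seq])
  finally show ?thesis
    by (simp add: power2_norm_eq_inner euclidean_inner[of v v] flip: power2_eq_square)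
qed

lemma topspace_nsphere_DIM:
  "topspace (nsphere (DIM('a::euclidean_space) - Suc 0)) = {x. (\<Sum>i<DIM('a). (x i)\<^sup>2) = 1 \<and> (\<forall>i\<ge>DIM('a). x i = 0)}"
proof -
  have "{..DIM('a) - Suc 0} = {..<DIM('a)}" and "\<And>i. i > DIM('a) - Suc 0 \<longleftrightarrow> i \<ge> DIM('a)"
    using DIM_positive[where 'a='a] by (auto simp del: DIM_positive)
  then show ?thesis
    by (simp add: nsphere)
qed

text \<open>Reduces continuity between abstract topologies to \<open>continuous_on\<close> for
  subsets of the type of sequences.\<close>

lemma nsphere_eq_top_of_set: "nsphere p = top_of_set (topspace (nsphere p))"
  by (simp add: nsphere euclidean_product_topology)

lemma coords_in_nsphere:
  "norm v = 1 \<Longrightarrow> coords v \<in> topspace (nsphere (DIM('a) - Suc 0))" for v :: "'a::euclidean_space"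
  unfolding topspace_nsphere_DIM using sum_coords_power2[of v] by (simp add: coords_def)

lemma coords_of_coords_nsphere:
  "x \<in> topspace (nsphere (DIM('a) - Suc 0)) \<Longrightarrow> coords (of_coords x :: 'a::euclidean_space) = x"
  by (rule coords_of_coords) (simp add: topspace_nsphere_DIM)

lemma norm_of_coords_nsphere:
  assumes "x \<in> topspace (nsphere (DIM('a) - Suc 0))"
  shows "norm (of_coords x :: 'a::euclidean_space) = 1"
proof -
  have "(norm (of_coords x :: 'a))\<^sup>2 = 1"
    using assms sum_coords_power2[of "of_coords x :: 'a"]
    by (simp add: coords_of_coords_nsphere) (simp add: topspace_nsphere_DIM)
  then show ?thesis
    by (simp add: power2_eq_1_iff) (use norm_ge_zero[of "of_coords x :: 'a"] in linarith)
qed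

lemma continuous_on_of_coords [continuous_intros]:
  "continuous_on S g \<Longrightarrow> continuous_on S (\<lambda>x. of_coords (g x))"
  unfolding of_coords_def
  by (intro continuous_on_sum continuous_on_scaleR continuous_on_const)
    (rule continuous_on_product_then_coordinatewise)

lemma continuous_on_coords [continuous_intros]:
  fixes g :: "'b::topological_space \<Rightarrow> 'a::euclidean_space"
  assumes "continuous_on S g"
  shows "continuous_on S (\<lambda>x. coords (g x))"
proof (rule continuous_on_coordinatewise_then_product)
  show "continuous_on S (\<lambda>x. coords (g x) i)" for i
    unfolding coords_def by (cases "i < DIM('a)") (auto intro!: continuous_intros assms)
qed

lemma sphere_degree_cong:
  assumes "\<And>x. norm x = 1 \<Longrightarrow> \<phi> x = \<psi> x"
  shows "sphere_degree \<phi> = sphere_degree \<psi>"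
  unfolding sphere_degree_def
  by (rule Brouwer_degree2_eq) (simp add: assms norm_of_coords_nsphere)

lemma sphere_degree_scaleR:
  "c > 0 \<Longrightarrow> sphere_degree (\<lambda>x. c *\<^sub>R \<phi> x) = sphere_degree \<phi>"
  by (simp add: sphere_degree_def sgn_scaleR)

lemma sphere_degree_homotopy:
  fixes H :: "real \<times> 'a::euclidean_space \<Rightarrow> 'a"
  assumes cont: "continuous_on ({0..1} \<times> sphere 0 1) H"
    and nz: "\<And>t x. t \<in> {0..1} \<Longrightarrow> norm x = 1 \<Longrightarrow> H (t, x) \<noteq> 0"
  shows "sphere_degree (\<lambda>x. H (0, x)) = sphere_degree (\<lambda>x. H (1, x))"
  unfolding sphere_degree_def
proof (rule Brouwer_degree2_homotopic)
  let ?N = "nsphere (DIM('a) - Suc 0)"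
  let ?h = "\<lambda>p. coords (sgn (H (fst p, of_coords (snd p))))"
  have H: "continuous_on ({0..1} \<times> topspace ?N) (\<lambda>p. H (fst p, of_coords (snd p)))"
    by (rule continuous_on_compose2[OF cont])
      (intro continuous_on_Pair continuous_on_fst continuous_on_snd continuous_on_of_coords
         continuous_on_id, auto simp: norm_of_coords_nsphere)
  have "continuous_on ({0..1} \<times> topspace ?N) ?h"
    by (intro continuous_on_coords continuous_on_sgn H) (auto simp: nz norm_of_coords_nsphere)
  moreover have "?h \<in> {0..1} \<times> topspace ?N \<rightarrow> topspace ?N"
    by (intro Pi_I coords_in_nsphere) (auto simp: nz norm_of_coords_nsphere norm_sgn)
  ultimately have "continuous_map (top_of_set ({0..1} \<times> topspace ?N)) (top_of_set (topspace ?N)) ?h"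
    by (simp add: continuous_map_in_subtopology image_subset_iff_funcset)
  then have "continuous_map (prod_topology (top_of_set {0..1}) ?N) ?N ?h"
    by (subst (1 2) nsphere_eq_top_of_set) simp
  then show "homotopic_with (\<lambda>x. True) ?N ?N
      (\<lambda>x. coords (sgn (H (0, of_coords x)))) (\<lambda>x. coords (sgn (H (1, of_coords x))))"
    unfolding homotopic_with_def by (intro exI[of _ ?h]) simp
qed

lemma continuous_map_nsphere_coords:
  fixes \<phi> :: "'a::euclidean_space \<Rightarrow> 'a"
  assumes cont: "continuous_on (sphere 0 1) \<phi>" and nz: "\<And>x. norm x = 1 \<Longrightarrow> \<phi> x \<noteq> 0"
  shows "continuous_map (nsphere (DIM('a) - Suc 0)) (nsphere (DIM('a) - Suc 0))
           (\<lambda>x. coords (sgn (\<phi> (of_coords x))))"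
proof -
  let ?N = "nsphere (DIM('a) - Suc 0)"
  let ?h = "\<lambda>x. coords (sgn (\<phi> (of_coords x)))"
  have "continuous_on (topspace ?N) (\<lambda>x. \<phi> (of_coords x))"
    by (rule continuous_on_compose2[OF cont])
      (intro continuous_on_of_coords continuous_on_id, auto simp: norm_of_coords_nsphere)
  then have "continuous_on (topspace ?N) ?h"
    by (intro continuous_on_coords continuous_on_sgn) (auto simp: nz norm_of_coords_nsphere)
  moreover have "?h \<in> topspace ?N \<rightarrow> topspace ?N"
    by (intro Pi_I coords_in_nsphere) (auto simp: nz norm_of_coords_nsphere norm_sgn)
  ultimately have "continuous_map (top_of_set (topspace ?N)) (top_of_set (topspace ?N)) ?h"
    by (simp add: continuous_map_in_subtopology image_subset_iff_funcset)
  then show ?thesis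
    by (simp flip: nsphere_eq_top_of_set)
qed

lemma sphere_degree_compose:
  fixes \<phi> \<psi> :: "'a::euclidean_space \<Rightarrow> 'a"
  assumes "continuous_on (sphere 0 1) \<phi>" "\<And>x. norm x = 1 \<Longrightarrow> \<phi> x \<noteq> 0"
    and "continuous_on (sphere 0 1) \<psi>" "\<And>x. norm x = 1 \<Longrightarrow> \<psi> x \<noteq> 0"
  shows "sphere_degree (\<lambda>x. \<psi> (sgn (\<phi> x))) = sphere_degree \<psi> * sphere_degree \<phi>"
  using Brouwer_degree2_compose[OF continuous_map_nsphere_coords[OF assms(1,2)]
      continuous_map_nsphere_coords[OF assms(3,4)]]
  by (simp add: sphere_degree_def o_def of_coords_coords)

text \<open>In coordinates this map is the sign change of entry 0, to which
  \<open>Brouwer_degree2_reflection\<close> applies.\<close>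

lemma sphere_degree_reflection_basis_seq:
  "sphere_degree (\<lambda>x::'a::euclidean_space. x - (2 * (x \<bullet> basis_seq 0)) *\<^sub>R basis_seq 0) = -1"
proof -
  let ?N = "nsphere (DIM('a) - Suc 0)" and ?b = "basis_seq 0 :: 'a"
  have "coords (sgn (of_coords x - (2 * (of_coords x \<bullet> ?b)) *\<^sub>R ?b))
        = (\<lambda>i. if i = 0 then - x i else x i)" (is "coords (sgn ?v) = ?r")
    if x: "x \<in> topspace ?N" for x
  proof -
    have "x i = 0" if "i \<ge> DIM('a)" for i
      using x that by (simp only: topspace_nsphere_DIM) simp
    then have "coords ?v i = ?r i" for i
      using inner_basis_seq[of 0 i, where 'a='a] DIM_positive[where 'a='a]
      by (auto simp: coords_def inner_diff_left of_coords_inner_basis_seq)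
    then have v: "coords ?v = ?r" ..
    have "(norm ?v)\<^sup>2 = (\<Sum>i<DIM('a). (?r i)\<^sup>2)"
      by (simp only: v flip: sum_coords_power2)
    also have "\<dots> = (\<Sum>i<DIM('a). (x i)\<^sup>2)"
      by (rule sum.cong) auto
    also have "\<dots> = 1"
      using x by (simp add: topspace_nsphere_DIM)
    finally have "norm ?v = 1"
      by (simp add: power2_eq_1_iff) (use norm_ge_zero[of ?v] in linarith)
    then show ?thesis
      by (simp add: sgn_div_norm v)
  qed
  then show ?thesis
    unfolding sphere_degree_def
    by (subst Brouwer_degree2_eq[where g = "\<lambda>x i. if i = 0 then - x i else x i"])
      (simp_all add: Brouwer_degree2_reflection)
qed

text \<open>Pairing the reflected vector with \<open>u\<close> gives the negative of
  \<open>x \<bullet> u\<close>. If the former vanishes, so does the latter, and only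
  \<open>x\<close> remains of the formula.\<close>

lemma reflection_eq_0_iff:
  fixes u x :: "'a::real_inner"
  assumes "norm u = 1"
  shows "x - (2 * (x \<bullet> u)) *\<^sub>R u = 0 \<longleftrightarrow> x = 0"
proof
  assume eq: "x - (2 * (x \<bullet> u)) *\<^sub>R u = 0"
  then have "(x - (2 * (x \<bullet> u)) *\<^sub>R u) \<bullet> u = 0"
    by (simp only: inner_zero_left)
  then have "x \<bullet> u = 0"
    using assms by (simp add: inner_diff_left dot_square_norm)
  then show "x = 0"
    using eq by simp
qed simp

text \<open>From dimension 2 on the unit sphere is path connected. Moving the normal vector along a
  path to \<open>basis_seq 0\<close> gives a homotopy through reflections, none of which has a zero
  on the sphere.\<close>

lemma sphere_degree_reflection:
  fixes u :: "'a::euclidean_space"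
  assumes u: "norm u = 1" and dim: "2 \<le> DIM('a)"
  shows "sphere_degree (\<lambda>x. x - (2 * (x \<bullet> u)) *\<^sub>R u) = -1"
proof -
  let ?b = "basis_seq 0 :: 'a"
  have "?b \<in> sphere 0 1" "u \<in> sphere 0 1"
    using u by (simp_all add: basis_seq_in_Basis)
  moreover have "path_connected (sphere (0::'a) 1)"
    by (rule path_connected_sphere[OF dim])
  ultimately obtain g where g: "path g" "path_image g \<subseteq> sphere 0 1" "pathstart g = ?b" "pathfinish g = u"
    unfolding path_connected_def by blast
  have gt: "norm (g t) = 1" if "t \<in> {0..1}" for t
    using g(2) that by (auto simp: path_image_def image_subset_iff)
  let ?H = "\<lambda>p::real \<times> 'a. snd p - (2 * (snd p \<bullet> g (fst p))) *\<^sub>R g (fst p)"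
  have "continuous_on ({0..1} \<times> sphere 0 1) (\<lambda>p::real \<times> 'a. g (fst p))"
    by (rule continuous_on_compose2[of "{0..1}" g]) (use g(1) in \<open>auto simp: path_def intro!: continuous_intros\<close>)
  then have "continuous_on ({0..1} \<times> sphere 0 1) ?H"
    by (intro continuous_intros)
  moreover have "?H (t, x) \<noteq> 0" if "t \<in> {0..1}" "norm x = 1" for t x
    using that reflection_eq_0_iff[OF gt[OF that(1)], of x] by auto
  ultimately have "sphere_degree (\<lambda>x. ?H (0, x)) = sphere_degree (\<lambda>x. ?H (1, x))"
    by (rule sphere_degree_homotopy)
  then show ?thesis
    using g(3,4) sphere_degree_reflection_basis_seq[where 'a='a]
    by (simp add: pathstart_def pathfinish_def)
qed

section \<open>The local degree of continuous injective maps\<close>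

text \<open>Injectivity keeps the increment nonzero on the small sphere. The radius is an arbitrary
  choice, justified by \<open>local_degree_eq_sphere_degree\<close>.\<close>

definition local_degree :: "'a::euclidean_space set \<Rightarrow> ('a \<Rightarrow> 'a) \<Rightarrow> 'a \<Rightarrow> int" where
  "local_degree U F a =
     (let e = (SOME e. 0 < e \<and> cball a e \<subseteq> U) in sphere_degree (\<lambda>x. F (a + e *\<^sub>R x) - F a))"

text \<open>Centre and radius vary together, so that one homotopy serves both for changing the
  radius and for moving the point.\<close>

lemma sphere_degree_increment_path:
  fixes F :: "'a::euclidean_space \<Rightarrow> 'a"
  assumes F: "continuous_on U F" "inj_on F U"
    and c: "continuous_on {0..1} c" and e: "continuous_on {0..1} e"
    and ball: "\<And>t. t \<in> {0..1} \<Longrightarrow> 0 < e t \<and> cball (c t) (e t) \<subseteq> U"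
  shows "sphere_degree (\<lambda>x. F (c 0 + e 0 *\<^sub>R x) - F (c 0)) =
         sphere_degree (\<lambda>x. F (c 1 + e 1 *\<^sub>R x) - F (c (1::real)))"
proof -
  let ?S = "{0..1} \<times> sphere (0::'a) 1"
  let ?H = "\<lambda>p. F (c (fst p) + e (fst p) *\<^sub>R snd p) - F (c (fst p))"
  have mem: "c t + e t *\<^sub>R x \<in> U" "c t \<in> U" "e t > 0" if "t \<in> {0..1}" "norm x = 1" for t x
  proof -
    have "c t + e t *\<^sub>R x \<in> cball (c t) (e t)" "c t \<in> cball (c t) (e t)"
      using ball[OF that(1)] that(2) by (simp_all add: dist_norm)
    then show "c t + e t *\<^sub>R x \<in> U" "c t \<in> U" "e t > 0"
      using ball[OF that(1)] by blast+
  qed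
  have c': "continuous_on ?S (\<lambda>p. c (fst p))"
    by (rule continuous_on_compose2[OF c]) (auto intro: continuous_on_fst continuous_on_id)
  have e': "continuous_on ?S (\<lambda>p. e (fst p))"
    by (rule continuous_on_compose2[OF e]) (auto intro: continuous_on_fst continuous_on_id)
  have "continuous_on ?S (\<lambda>p. c (fst p) + e (fst p) *\<^sub>R snd p)"
    by (intro continuous_on_add continuous_on_scaleR c' e' continuous_on_snd continuous_on_id)
  then have "continuous_on ?S (\<lambda>p. F (c (fst p) + e (fst p) *\<^sub>R snd p))"
    by (rule continuous_on_compose2[OF F(1)]) (auto simp: mem)
  moreover have "continuous_on ?S (\<lambda>p. F (c (fst p)))"
    by (rule continuous_on_compose2[OF F(1) c']) (auto intro: mem)
  ultimately have "continuous_on ?S ?H"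
    by (rule continuous_on_diff)
  moreover have "?H (t, x) \<noteq> 0" if tx: "t \<in> {0..1}" "norm x = 1" for t x
  proof
    assume "?H (t, x) = 0"
    then have "c t + e t *\<^sub>R x = c t"
      using inj_onD[OF F(2), of "c t + e t *\<^sub>R x" "c t"] mem[OF tx] by simp
    then show False
      using mem(3)[OF tx] tx(2) by auto
  qed
  ultimately have "sphere_degree (\<lambda>x. ?H (0, x)) = sphere_degree (\<lambda>x. ?H (1, x))"
    by (rule sphere_degree_homotopy)
  then show ?thesis
    by simp
qed

text \<open>The chosen radius \<open>d\<close> is deformed linearly into \<open>e\<close>. Every
  intermediate ball lies in the larger of the two balls, hence in \<open>U\<close>.\<close>

lemma local_degree_eq_sphere_degree:
  assumes F: "continuous_on U F" "inj_on F U" and e: "0 < e" "cball a e \<subseteq> U"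
  shows "local_degree U F a = sphere_degree (\<lambda>x. F (a + e *\<^sub>R x) - F a)"
proof -
  define d where "d = (SOME d. 0 < d \<and> cball a d \<subseteq> U)"
  have d: "0 < d \<and> cball a d \<subseteq> U"
    unfolding d_def by (rule someI[of _ e]) (use e in simp)
  have "0 < (1 - t) * d + t * e \<and> cball a ((1 - t) * d + t * e) \<subseteq> U" if "t \<in> {0..1}" for t
  proof -
    have "(1 - t) * d + t * e \<le> max d e"
      using that by (intro convex_bound_le) auto
    then have "cball a ((1 - t) * d + t * e) \<subseteq> cball a (max d e)"
      by (rule subset_cball)
    also have "\<dots> \<subseteq> U"
      using d e by (simp add: max_def)
    finally have "cball a ((1 - t) * d + t * e) \<subseteq> U" .
    moreover have "0 < (1 - t) * d + t * e"
    proof (cases "t = 0")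
      case False
      with that have "0 < t * e" "0 \<le> (1 - t) * d"
        using d e by auto
      then show ?thesis by simp
    qed (use d in simp)
    ultimately show ?thesis by blast
  qed
  then show ?thesis
    using sphere_degree_increment_path[OF F, of "\<lambda>_. a" "\<lambda>t. (1 - t) * d + t * e"]
    by (simp add: local_degree_def Let_def d_def continuous_intros)
qed

text \<open>The image of the path is compact, so one radius fits all its points; halving it passes
  from open to closed balls.\<close>

lemma local_degree_path:
  assumes F: "continuous_on U F" "inj_on F U" and "open U"
    and g: "path g" "path_image g \<subseteq> U"
  shows "local_degree U F (pathstart g) = local_degree U F (pathfinish g)"
proof -
  obtain e where e: "0 < e" "(\<Union>x\<in>path_image g. ball x e) \<subseteq> U"
    using compact_subset_open_imp_ball_epsilon_subset[OF compact_path_image[OF g(1)] \<open>open U\<close> g(2)]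
    by blast
  have ball: "cball (g t) (e / 2) \<subseteq> U" if "t \<in> {0..1}" for t
  proof -
    have "cball (g t) (e / 2) \<subseteq> ball (g t) e"
      using e(1) by (auto simp: mem_ball)
    also have "\<dots> \<subseteq> U"
      using e(2) that unfolding path_image_def by blast
    finally show ?thesis .
  qed
  have "sphere_degree (\<lambda>x. F (g 0 + (e / 2) *\<^sub>R x) - F (g 0)) =
        sphere_degree (\<lambda>x. F (g 1 + (e / 2) *\<^sub>R x) - F (g 1))"
    using sphere_degree_increment_path[OF F, of g "\<lambda>_. e / 2"] g(1) e(1) ball
    by (simp add: path_def)
  then show ?thesis
    using local_degree_eq_sphere_degree[OF F, of "e / 2" "g 0"] ball[of 0] 
      local_degree_eq_sphere_degree[OF F, of "e / 2" "g 1"] ball[of 1] e(1)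
    by (simp add: pathstart_def pathfinish_def)
qed

text \<open>The increment of \<open>F\<close> on a small sphere takes values in a punctured ball
  around 0 on which the increment of \<open>G\<close> has no zero. Pushing these values radially to
  the sphere of radius \<open>r\<close> turns the composite into one of maps between spheres, where
  degrees multiply.\<close>

lemma local_degree_compose:
  fixes F G :: "'a::euclidean_space \<Rightarrow> 'a"
  assumes F: "continuous_on U F" "inj_on F U" and G: "continuous_on V G" "inj_on G V"
    and "open U" "open V" "F ` U \<subseteq> V" "a \<in> U"
  shows "local_degree U (G \<circ> F) a = local_degree V G (F a) * local_degree U F a"
proof -
  define b where "b = F a"
  have "b \<in> V"
    using assms by (auto simp: b_def)
  then obtain r where r: "0 < r" "cball b r \<subseteq> V"
    using \<open>open V\<close> open_contains_cball_eq by blast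
  have "open (U \<inter> F -` ball b r)"
    by (rule continuous_open_preimage[OF F(1) \<open>open U\<close> open_ball])
  moreover have "a \<in> U \<inter> F -` ball b r"
    using \<open>a \<in> U\<close> r by (simp add: b_def)
  ultimately obtain d where d: "0 < d" "cball a d \<subseteq> U \<inter> F -` ball b r"
    using open_contains_cball_eq by blast
  define \<phi> where "\<phi> = (\<lambda>x. F (a + d *\<^sub>R x) - b)"
  define \<psi> where "\<psi> = (\<lambda>y. G (b + r *\<^sub>R y) - G b)"
  have sph: "a + d *\<^sub>R x \<in> cball a d" "b + r *\<^sub>R x \<in> V" if "norm x = 1" for x
  proof -
    show "a + d *\<^sub>R x \<in> cball a d"
      using that d by (simp add: dist_norm)
    have "b + r *\<^sub>R x \<in> cball b r"
      using that r by (simp add: dist_norm)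
    then show "b + r *\<^sub>R x \<in> V"
      using r by blast
  qed
  have \<phi>_nz: "\<phi> x \<noteq> 0" if "norm x = 1" for x
  proof
    assume "\<phi> x = 0"
    then have "a + d *\<^sub>R x = a"
      using inj_onD[OF F(2), of "a + d *\<^sub>R x" a] sph(1)[OF that] d(2) \<open>a \<in> U\<close>
      by (auto simp: \<phi>_def b_def)
    then show False
      using d that by auto
  qed
  have G_nz: "G (b + y) - G b \<noteq> 0" if "y \<noteq> 0" "norm y \<le> r" for y
  proof
    assume "G (b + y) - G b = 0"
    moreover have "b + y \<in> V"
      using r that by (auto simp: dist_norm)
    ultimately have "b + y = b"
      using inj_onD[OF G(2), of "b + y" b] \<open>b \<in> V\<close> by simp
    then show False
      using that by simp
  qed
  have \<phi>_le: "norm (\<phi> x) \<le> r" if "norm x = 1" for x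
  proof -
    have "F (a + d *\<^sub>R x) \<in> ball b r"
      using sph(1)[OF that] d(2) by blast
    then show ?thesis
      by (simp add: \<phi>_def dist_norm norm_minus_commute)
  qed
  have cont_\<phi>: "continuous_on (sphere 0 1) \<phi>"
    unfolding \<phi>_def
    by (intro continuous_on_diff continuous_on_const continuous_on_compose2[OF F(1)]
        continuous_on_add continuous_on_scaleR continuous_on_id) (use sph(1) d(2) in auto)
  have cont_\<psi>: "continuous_on (sphere 0 1) \<psi>"
    unfolding \<psi>_def
    by (intro continuous_on_diff continuous_on_const continuous_on_compose2[OF G(1)]
        continuous_on_add continuous_on_scaleR continuous_on_id) (use sph(2) in auto)
  \<comment> \<open>The scaling factor runs linearly from 1 to \<open>r / norm (\<phi> x)\<close>,
    so the norm of the scaled vector runs from that of \<open>\<phi> x\<close> to \<open>r\<close>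
    and never exceeds \<open>r\<close>.\<close>
  let ?s = "\<lambda>p. (1 - fst p) + fst p * (r / norm (\<phi> (snd p)))"
  let ?H = "\<lambda>p. G (b + ?s p *\<^sub>R \<phi> (snd p)) - G b"
  have s: "?s (t, x) > 0" "norm (?s (t, x) *\<^sub>R \<phi> x) \<le> r" if "t \<in> {0..1}" "norm x = 1" for t x
  proof -
    have pos: "norm (\<phi> x) > 0"
      using \<phi>_nz[OF that(2)] by simp
    then show *: "?s (t, x) > 0"
      using that(1) r(1) by (cases "t = 0") (auto intro!: add_nonneg_pos)
    have "norm (?s (t, x) *\<^sub>R \<phi> x) = (1 - t) * norm (\<phi> x) + t * r"
      using * pos by (simp add: field_simps)
    also have "\<dots> \<le> r"
      using that \<phi>_le[OF that(2)] by (intro convex_bound_le) auto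
    finally show "norm (?s (t, x) *\<^sub>R \<phi> x) \<le> r" .
  qed
  have "sphere_degree (\<lambda>x. ?H (0, x)) = sphere_degree (\<lambda>x. ?H (1, x))"
  proof (rule sphere_degree_homotopy)
    have \<phi>': "continuous_on ({0..1} \<times> sphere 0 1) (\<lambda>p::real \<times> 'a. \<phi> (snd p))"
      by (rule continuous_on_compose2[OF cont_\<phi>]) (auto intro: continuous_on_snd continuous_on_id)
    show "continuous_on ({0..1} \<times> sphere 0 1) ?H"
    proof (intro continuous_on_diff continuous_on_const continuous_on_compose2[OF G(1)])
      show "continuous_on ({0..1} \<times> sphere 0 1) (\<lambda>p. b + ?s p *\<^sub>R \<phi> (snd p))"
        by (intro continuous_intros \<phi>') (auto simp: \<phi>_nz)
      show "(\<lambda>p. b + ?s p *\<^sub>R \<phi> (snd p)) ` ({0..1} \<times> sphere 0 1) \<subseteq> V"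
        using s(2) r(2) by (fastforce simp: dist_norm)
    qed
    show "?H (t, x) \<noteq> 0" if "t \<in> {0..1}" "norm x = 1" for t x
      using s[OF that] \<phi>_nz[OF that(2)] by (intro G_nz) auto
  qed
  also have "\<dots> = sphere_degree (\<lambda>x. \<psi> (sgn (\<phi> x)))"
    by (simp add: \<psi>_def sgn_div_norm divide_inverse)
  also have "\<dots> = sphere_degree \<psi> * sphere_degree \<phi>"
  proof (intro sphere_degree_compose cont_\<phi> cont_\<psi> \<phi>_nz)
    show "\<psi> y \<noteq> 0" if "norm y = 1" for y
      unfolding \<psi>_def using r(1) that by (intro G_nz) auto
  qed
  also have "sphere_degree \<psi> = local_degree V G (F a)"
    using local_degree_eq_sphere_degree[OF G r] by (simp add: \<psi>_def b_def)
  also have "sphere_degree \<phi> = local_degree U F a"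
    using local_degree_eq_sphere_degree[OF F d(1)] d(2) by (simp add: \<phi>_def b_def)
  finally have "sphere_degree (\<lambda>x. G (F (a + d *\<^sub>R x)) - G b) = local_degree V G (F a) * local_degree U F a"
    by (simp add: \<phi>_def)
  moreover have "continuous_on U (G \<circ> F)" "inj_on (G \<circ> F) U"
    using continuous_on_compose[OF F(1) continuous_on_subset[OF G(1)]]
      comp_inj_on[OF F(2) inj_on_subset[OF G(2)]] \<open>F ` U \<subseteq> V\<close> by simp_all
  ultimately show ?thesis
    using local_degree_eq_sphere_degree[of U "G \<circ> F" d a] d by (simp add: b_def)
qed

lemma local_degree_compose_self:
  assumes F: "continuous_on U F" "inj_on F U" and "open U" "F ` U \<subseteq> U"
    and path: "path_component U a (F a)"
  shows "local_degree U (F \<circ> F) a = (local_degree U F a)\<^sup>2"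
proof -
  obtain g where g: "path g" "path_image g \<subseteq> U" "pathstart g = a" "pathfinish g = F a"
    using path unfolding path_component_def by blast
  then have "a \<in> U"
    using pathstart_in_path_image by blast
  then show ?thesis
    using local_degree_compose[OF F F \<open>open U\<close> \<open>open U\<close> \<open>F ` U \<subseteq> U\<close>]
      local_degree_path[OF F \<open>open U\<close> g(1,2)] g(3,4)
    by (simp add: power2_eq_square)
qed

section \<open>Real matrices\<close>

lemma det_scaleR: "det (c *\<^sub>R A) = c ^ CARD('n) * det (A :: real^'n^'n)"
proof -
  have "det (c *\<^sub>R A) = det (c *\<^sub>R mat 1 ** A)"
    by (simp flip: scalar_matrix_assoc)
  also have "\<dots> = det (c *\<^sub>R (mat 1 :: real^'n^'n)) * det A"
    by (simp only: det_mul)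
  also have "det (c *\<^sub>R (mat 1 :: real^'n^'n)) = c ^ CARD('n)"
    by (subst det_diagonal) (simp_all add: mat_def)
  finally show ?thesis .
qed

lemma continuous_on_det [continuous_intros]:
  fixes g :: "'a::topological_space \<Rightarrow> real^'n^'n"
  shows "continuous_on S g \<Longrightarrow> continuous_on S (\<lambda>x. det (g x))"
  unfolding det_def by (intro continuous_intros)

lemma continuous_on_matrix_mult [continuous_intros]:
  fixes g :: "'a::topological_space \<Rightarrow> real^'n^'m" and h :: "'a \<Rightarrow> real^'k^'n"
  assumes "continuous_on S g" "continuous_on S h"
  shows "continuous_on S (\<lambda>x. g x ** h x)"
  unfolding matrix_matrix_mult_def by (intro continuous_intros assms)

lemma matrix_add_rdistrib: "(B + C) ** A = B ** A + C ** (A :: real^'n^'m)"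
  by (simp add: vec_eq_iff matrix_matrix_mult_def sum.distrib algebra_simps)

lemma matrix_diff_ldistrib: "A ** (B - C) = A ** B - A ** (C :: real^'n^'m)"
  using matrix_add_ldistrib[of A "B - C" C] by (simp add: algebra_simps)

lemma matrix_diff_rdistrib: "(B - C) ** A = B ** A - C ** (A :: real^'n^'m)"
  using matrix_add_rdistrib[of "B - C" C A] by (simp add: algebra_simps)

lemma matrix_uminus_left: "(- A) ** B = - (A ** (B :: real^'n^'m))"
  using matrix_diff_rdistrib[of 0 A B] by simp

lemma matrix_uminus_right: "A ** (- B) = - (A ** (B :: real^'n^'m))"
  using matrix_diff_ldistrib[of A 0 B] by simp

lemmas matrix_algebra_simps =
  matrix_add_ldistrib matrix_add_rdistrib matrix_diff_ldistrib matrix_diff_rdistrib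
  matrix_uminus_left matrix_uminus_right matrix_scalar_ac scalar_matrix_assoc[symmetric]

lemma matrix_mult_right_cancel:
  fixes A B C :: "real^'n^'n"
  assumes "A ** C = B ** C" "det C \<noteq> 0"
  shows "A = B"
proof -
  obtain D where "C ** D = mat 1"
    using assms(2) invertible_det_nz invertible_def by blast
  then show ?thesis
    using arg_cong[OF assms(1), of "\<lambda>M. M ** D"] by (simp flip: matrix_mul_assoc)
qed

lemma matrix_mult_left_cancel:
  fixes A B C :: "real^'n^'n"
  assumes "C ** A = C ** B" "det C \<noteq> 0"
  shows "A = B"
proof -
  obtain D where "D ** C = mat 1"
    using assms(2) invertible_det_nz invertible_def by blast
  then show ?thesis
    using arg_cong[OF assms(1), of "\<lambda>M. D ** M"] by (simp add: matrix_mul_assoc)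
qed

text \<open>Cancel A + 1 in (A - 1)(A + 1) = 0. This isolates the identity among the involutions: if
  A is close to 1, then A + 1 is close to the invertible matrix 2 * 1.\<close>

lemma involutive_matrix_eq_mat_1:
  fixes A :: "real^'n^'n"
  assumes "A ** A = mat 1" "det (A + mat 1) \<noteq> 0"
  shows "A = mat 1"
proof (rule matrix_mult_right_cancel[OF _ assms(2)])
  show "A ** (A + mat 1) = mat 1 ** (A + mat 1)"
    using assms(1) by (simp add: matrix_add_ldistrib add.commute)
qed

text \<open>\<open>E\<close> is the matrix unit at position (i, j). Row i of \<open>E ** A\<close>
  is row j of \<open>A\<close>, column j of \<open>A ** E\<close> is column i of \<open>A\<close>,
  and all other entries of the products vanish.\<close>

lemma scalar_matrix_if_commutes:
  fixes A :: "real^'n^'n"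
  assumes comm: "\<And>i j E. i \<noteq> j \<Longrightarrow> E = (\<chi> k l. if k = i \<and> l = j then 1 else 0) \<Longrightarrow> E ** A = A ** E"
  shows "\<exists>c. A = c *\<^sub>R mat 1"
proof -
  have entries: "(if k = i then A $ j $ l else 0) = (if l = j then A $ k $ i else 0)" if "i \<noteq> j" for i j k l
  proof -
    let ?E = "\<chi> k l. if k = i \<and> l = j then 1 else (0::real)"
    have "(?E ** A) $ k $ l = (A ** ?E) $ k $ l"
      using comm[OF that refl] by simp
    moreover have "(?E ** A) $ k $ l = (\<Sum>m\<in>UNIV. if m = j then if k = i then A $ j $ l else 0 else 0)"
      unfolding matrix_matrix_mult_def vec_lambda_beta by (rule sum.cong) auto
    moreover have "(A ** ?E) $ k $ l = (\<Sum>m\<in>UNIV. if m = i then if l = j then A $ k $ i else 0 else 0)"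
      unfolding matrix_matrix_mult_def vec_lambda_beta by (rule sum.cong) auto
    ultimately show ?thesis by simp
  qed
  obtain i0 :: 'n where True
    by simp
  define c where "c = A $ i0 $ i0"
  \<comment> \<open>The first instance below equates all diagonal entries with the one at
    \<open>i0\<close>, the second makes the off-diagonal entries vanish.\<close>
  have "A $ k $ l = (if k = l then c else 0)" for k l
    unfolding c_def
    using entries[of k i0 k i0] entries[of l k l l] by (cases "k = l"; cases "k = i0") auto
  then have "A = c *\<^sub>R mat 1"
    by (simp add: vec_eq_iff mat_def)
  then show ?thesis ..
qed

text \<open>A bijection \<open>g\<close> from half of the indices to the other half pairs them up;
  \<open>J\<close> is a quarter turn in each of the resulting coordinate planes.\<close>

lemma ex_matrix_square_eq_neg_mat_1:
  assumes "even CARD('n::finite)"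
  shows "\<exists>J :: real^'n^'n. J ** J = - mat 1"
proof -
  obtain S :: "'n set" where S: "card S = CARD('n) div 2"
    using obtain_subset_with_card_n[of "CARD('n) div 2" "UNIV :: 'n set"] by auto
  then have "card (- S) = card S"
    using assms by (auto simp: Compl_eq_Diff_UNIV card_Diff_subset elim!: evenE)
  then obtain g where g: "bij_betw g S (- S)"
    by (metis finite finite_same_card_bij)
  define h where "h = inv_into S g"
  have gh: "g i \<in> - S" "h (g i) = i" if "i \<in> S" for i
    using g that by (auto simp: bij_betw_def h_def)
  have hg: "h i \<in> S" "g (h i) = i" if "i \<notin> S" for i
    using g that by (auto simp: bij_betw_def h_def f_inv_into_f inv_into_into)
  define J :: "real^'n^'n" where
    "J = (\<chi> i j. if i \<in> S then if j = g i then 1 else 0 else if j = h i then -1 else 0)"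
  have row_S: "J $ i $ j = (if j = g i then 1 else 0)" if "i \<in> S" for i j
    using that by (simp add: J_def)
  have row_not_S: "J $ i $ j = (if j = h i then -1 else 0)" if "i \<notin> S" for i j
    using that by (simp add: J_def)
  have "(J ** J) $ i $ j = (- mat 1) $ i $ j" for i j
  proof (cases "i \<in> S")
    case True
    then have "(J ** J) $ i $ j = (\<Sum>k\<in>UNIV. if k = g i then J $ g i $ j else 0)"
      unfolding matrix_matrix_mult_def vec_lambda_beta by (intro sum.cong) (auto simp: row_S)
    then show ?thesis
      using True gh[of i] by (auto simp: row_not_S mat_def)
  next
    case False
    then have "(J ** J) $ i $ j = (\<Sum>k\<in>UNIV. if k = h i then - J $ h i $ j else 0)"
      unfolding matrix_matrix_mult_def vec_lambda_beta by (intro sum.cong) (auto simp: row_not_S)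
    then show ?thesis
      using False hg[of i] by (auto simp: row_S mat_def)
  qed
  then show ?thesis
    by (auto simp: vec_eq_iff)
qed

text \<open>The matrix has the inverse cos t - (sin t) J, so its determinant never vanishes. As it
  equals 1 at t = 0, the intermediate value theorem keeps it positive.\<close>

lemma det_rotation_pos:
  fixes J :: "real^'n^'n"
  assumes J: "J ** J = - mat 1"
  shows "det (cos t *\<^sub>R mat 1 + sin t *\<^sub>R J) > 0"
proof (rule ccontr)
  let ?r = "\<lambda>t. cos t *\<^sub>R mat 1 + sin t *\<^sub>R J"
  have nz: "det (?r s) \<noteq> 0" for s
  proof -
    have "?r s ** (cos s *\<^sub>R mat 1 - sin s *\<^sub>R J) = (cos s * cos s) *\<^sub>R mat 1 + (sin s * sin s) *\<^sub>R mat 1"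
      by (simp add: matrix_algebra_simps J scaleR_add_right scaleR_diff_right mult.commute)
    also have "\<dots> = mat 1"
      by (simp flip: scaleR_add_left)
    finally have "?r s ** (cos s *\<^sub>R mat 1 - sin s *\<^sub>R J) = mat 1" .
    then have "det (?r s) * det (cos s *\<^sub>R mat 1 - sin s *\<^sub>R J) = 1"
      by (simp flip: det_mul)
    then show ?thesis by auto
  qed
  have cont: "continuous_on UNIV (\<lambda>s. det (?r s))"
    by (intro continuous_intros)
  assume "\<not> ?thesis"
  then have "det (?r t) \<le> 0" by simp
  moreover have "is_interval (range (\<lambda>s. det (?r s)))"
    using connected_continuous_image[OF cont connected_UNIV] by (simp add: is_interval_connected_1)
  moreover have "det (?r t) \<in> range (\<lambda>s. det (?r s))" "1 \<in> range (\<lambda>s. det (?r s))"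
    by (auto intro!: image_eqI[of _ _ 0])
  ultimately have "0 \<in> range (\<lambda>s. det (?r s))"
    using mem_is_interval_1_I zero_le_one by blast
  then show False
    using nz by auto
qed

lemma path_component_mat_1_neg_mat_1:
  assumes "even CARD('n::finite)"
  shows "path_component {A :: real^'n^'n. det A > 0} (mat 1) (- mat 1)"
proof -
  obtain J :: "real^'n^'n" where J: "J ** J = - mat 1"
    using ex_matrix_square_eq_neg_mat_1[OF assms] by blast
  let ?g = "\<lambda>t. cos (pi * t) *\<^sub>R mat 1 + sin (pi * t) *\<^sub>R J"
  have "path ?g"
    unfolding path_def by (intro continuous_intros)
  moreover have "path_image ?g \<subseteq> {A. det A > 0}"
    using det_rotation_pos[OF J] by (auto simp: path_image_def)
  ultimately show ?thesis
    unfolding path_component_def by (intro exI[of _ ?g]) (simp add: pathstart_def pathfinish_def)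
qed

text \<open>
  The identity is isolated among the involutions, and \<open>f\<close> permutes the involutions
  homeomorphically. An involution other than \<open>\<plusminus> 1\<close> fails to commute with some elementary
  matrix \<open>E\<close>, and then its conjugates by \<open>1 + t E\<close> are other involutions arbitrarily close to it.
\<close>

lemma inverse_square_root_mat_1_cases:
  fixes f :: "real^'n^'n \<Rightarrow> real^'n^'n"
  assumes f: "\<And>A. det A = 1 \<Longrightarrow> det (f A) = 1"
    and ff: "\<And>A. det A = 1 \<Longrightarrow> f (f A) ** A = mat 1"
    and cont: "continuous_on {A. det A = 1} f"
  shows "f (mat 1) = mat 1 \<or> f (mat 1) = - mat 1"
proof -
  define a where "a = f (mat 1)"
  have f_a: "f a = mat 1"
    using ff[of "mat 1"] by (simp add: a_def)
  have det_a: "det a = 1"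
    using f[of "mat 1"] by (simp add: a_def)
  have aa: "a ** a = mat 1"
    using ff[OF det_a] f_a by (simp add: a_def)
  have comm: "E ** a = a ** E" if "i \<noteq> j" and E: "E = (\<chi> k l. if k = i \<and> l = j then 1 else 0)"
    for i j and E :: "real^'n^'n"
  proof -
    \<comment> \<open>This is where an off-diagonal position is needed: since \<open>E\<close>
      squares to zero, 1 - t E is the exact inverse of 1 + t E for every t.\<close>
    have EE: "E ** E = 0"
      using \<open>i \<noteq> j\<close> by (auto simp: E matrix_matrix_mult_def vec_eq_iff intro!: sum.neutral)
    have E_inv: "(mat 1 + t *\<^sub>R E) ** (mat 1 - t *\<^sub>R E) = mat 1"
      "(mat 1 - t *\<^sub>R E) ** (mat 1 + t *\<^sub>R E) = mat 1" for t
      by (simp_all add: matrix_algebra_simps EE)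
    define b where "b = (\<lambda>t. (mat 1 + t *\<^sub>R E) ** a ** (mat 1 - t *\<^sub>R E))"
    have det_b: "det (b t) = 1" for t
    proof -
      have "det (b t) = det ((mat 1 + t *\<^sub>R E) ** (mat 1 - t *\<^sub>R E)) * det a"
        unfolding b_def det_mul by (simp only: mult_ac)
      then show ?thesis
        by (simp add: E_inv det_a)
    qed
    have bb: "b t ** b t = mat 1" for t
    proof -
      have "b t ** b t = (mat 1 + t *\<^sub>R E) ** a ** ((mat 1 - t *\<^sub>R E) ** (mat 1 + t *\<^sub>R E)) ** a ** (mat 1 - t *\<^sub>R E)"
        by (simp only: b_def matrix_mul_assoc)
      also have "\<dots> = (mat 1 + t *\<^sub>R E) ** (a ** a) ** (mat 1 - t *\<^sub>R E)"
        by (simp only: E_inv matrix_mul_rid matrix_mul_assoc)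
      finally show ?thesis
        by (simp add: aa E_inv)
    qed
    have f_f_b: "f (f (b t)) = b t" for t
      by (rule matrix_mult_right_cancel[where C = "b t"]) (simp_all add: ff bb det_b)
    have f_b_sq: "f (b t) ** f (b t) = mat 1" for t
      using ff[OF f[OF det_b], of t] by (simp add: f_f_b)
    have "continuous_on UNIV b"
      unfolding b_def by (intro continuous_intros)
    then have "continuous_on UNIV (\<lambda>t. f (b t))"
      by (rule continuous_on_compose2[OF cont]) (auto simp: det_b)
    then have "continuous_on UNIV (\<lambda>t. det (f (b t) + mat 1))"
      by (intro continuous_intros)
    then have "((\<lambda>t. det (f (b t) + mat 1)) \<longlongrightarrow> det (f (b 0) + mat 1)) (at 0)"
      by (simp add: continuous_on_def)
    \<comment> \<open>At t = 0 the conjugate is \<open>a\<close>, and \<open>f a\<close> is the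
      identity, so the determinant is 2 ^ n. It stays nonzero for small t, which forces the
      involution \<open>f (b t)\<close> to be the identity.\<close>
    moreover have "det (f (b 0) + mat 1) \<noteq> 0"
      using det_scaleR[of 2 "mat 1 :: real^'n^'n"] by (simp add: b_def f_a scaleR_2)
    ultimately have "\<forall>\<^sub>F t in at 0. det (f (b t) + mat 1) \<noteq> 0"
      by (rule tendsto_imp_eventually_ne)
    then have "\<forall>\<^sub>F t in at 0. t \<noteq> 0 \<and> det (f (b t) + mat 1) \<noteq> 0"
      using eventually_neq_at_within by (rule eventually_conj[rotated])
    then obtain t where t: "t \<noteq> 0" "det (f (b t) + mat 1) \<noteq> 0"
      using eventually_happens'[OF at_neq_bot] by blast
    then have "f (b t) = mat 1"
      using involutive_matrix_eq_mat_1 f_b_sq by blast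
    \<comment> \<open>Apply \<open>f\<close> to \<open>f (b t) = mat 1\<close>: the left side
      becomes \<open>b t\<close> and the right side \<open>a\<close>.\<close>
    then have "b t = a"
      using f_f_b[of t] by (simp add: a_def)
    then have "b t ** (mat 1 + t *\<^sub>R E) = a ** (mat 1 + t *\<^sub>R E)"
      by simp
    then have "(mat 1 + t *\<^sub>R E) ** a = a ** (mat 1 + t *\<^sub>R E)"
      by (simp add: b_def E_inv flip: matrix_mul_assoc)
    then show ?thesis
      using t(1) by (simp add: matrix_algebra_simps)
  qed
  then obtain c where c: "a = c *\<^sub>R mat 1"
    using scalar_matrix_if_commutes by blast
  then have "(c * c) *\<^sub>R (mat 1 :: real^'n^'n) = 1 *\<^sub>R mat 1"
    using aa by (simp add: matrix_algebra_simps)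
  moreover have "(mat 1 :: real^'n^'n) \<noteq> 0"
    by (simp add: vec_eq_iff mat_def)
  ultimately have "c * c = 1"
    using scaleR_cancel_right[of "c * c" "mat 1 :: real^'n^'n" 1] by blast
  then have "c = 1 \<or> c = -1"
    by (simp add: square_eq_1_iff)
  then show ?thesis
    using c by (auto simp: a_def)
qed

section \<open>The local degree of the scaled inverse at the identity\<close>

lemma open_det_pos: "open {A :: real^'n^'n. det A > 0}"
  by (intro open_Collect_less continuous_intros)

text \<open>The norm is the Euclidean one, so the true value is the square root of n. The bound
  ensures that a multiple k * 1 of norm 1 has |k| at most 1.\<close>

lemma norm_mat_1_ge_1: "1 \<le> norm (mat 1 :: real^'n^'n)"
proof -
  have "norm ((mat 1 :: real^'n^'n) $ i $ i) \<le> norm (mat 1 :: real^'n^'n)" for i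
    by (meson Finite_Cartesian_Product.norm_nth_le order_trans)
  then show ?thesis
    by (simp add: mat_def)
qed

text \<open>The last hypothesis determines \<open>H\<close> as det A ^ (2/n) * A^-1; in product form
  it keeps the inverse out of the computation. Instead of differentiating \<open>H\<close>, explicit
  homotopies lead to the reflection, and their zeros are excluded by algebra.\<close>

lemma local_degree_scaled_inverse:
  fixes H :: "real^'n^'n \<Rightarrow> real^'n^'n"
  assumes even: "even CARD('n)"
    and cont: "continuous_on {A. det A > 0} H" and inj: "inj_on H {A. det A > 0}"
    and H: "\<And>A. det A > 0 \<Longrightarrow> H A ** A = (root CARD('n) (det A))\<^sup>2 *\<^sub>R mat 1"
  shows "local_degree {A. det A > 0} H (mat 1) = -1"
proof -
  let ?U = "{A :: real^'n^'n. det A > 0}" and ?I = "mat 1 :: real^'n^'n"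
  let ?S = "{0..1::real} \<times> sphere (0 :: real^'n^'n) 1"
  have "?I \<in> ?U" by simp
  then obtain e0 where e0: "0 < e0" "cball ?I e0 \<subseteq> ?U"
    using open_contains_cball_eq[OF open_det_pos] by blast
  \<comment> \<open>With \<open>e\<close> at most 1/2, scalar matrices x = k * 1 of norm 1 satisfy
    |e k| <= 1/2. This keeps 1 + e k positive, as needed for the root, and 1 + (1 - t) e k
    nonzero.\<close>
  define e where "e = min e0 (1 / 2)"
  have e: "0 < e" "e \<le> 1 / 2" "cball ?I e \<subseteq> ?U"
    using e0 by (auto simp: e_def)
  have det_pos: "det (?I + c *\<^sub>R x) > 0" if "\<bar>c\<bar> \<le> e" "norm x = 1" for c x
  proof -
    have "?I + c *\<^sub>R x \<in> cball ?I e"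
      using that by (simp add: dist_norm)
    then show ?thesis
      using e(3) by blast
  qed
  have H_1: "H ?I = ?I"
    using H[of ?I] by simp
  \<comment> \<open>With this unit vector, 2 (x \<bullet> u) u is (2/n) tr(x) 1, the derivative at 1
    of the factor det ^ (2/n), times the identity.\<close>
  define u where "u = (1 / norm ?I) *\<^sub>R ?I"
  have norm_I: "norm ?I > 0"
    using norm_mat_1_ge_1[where 'n='n] by linarith
  then have norm_u: "norm u = 1"
    by (simp add: u_def)
  define s where "s = (\<lambda>x. root CARD('n) (det (?I + e *\<^sub>R x)))"

  \<comment> \<open>Multiplying the increment \<open>H (1 + e x) - 1\<close> on the right by \<open>1 + t e x\<close> removes the inverse.\<close>
  let ?H1 = "\<lambda>p. (H (?I + e *\<^sub>R snd p) - ?I) ** (?I + (fst p * e) *\<^sub>R snd p)"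
  have "local_degree ?U H ?I = sphere_degree (\<lambda>x. H (?I + e *\<^sub>R x) - H ?I)"
    by (rule local_degree_eq_sphere_degree[OF cont inj e(1,3)])
  also have "\<dots> = sphere_degree (\<lambda>x. ?H1 (0, x))"
    by (simp add: H_1)
  also have "\<dots> = sphere_degree (\<lambda>x. ?H1 (1, x))"
  proof (rule sphere_degree_homotopy)
    have "continuous_on ?S (\<lambda>p. H (?I + e *\<^sub>R snd p))"
    proof (rule continuous_on_compose2[OF cont])
      show "continuous_on ?S (\<lambda>p. ?I + e *\<^sub>R snd p)"
        by (intro continuous_intros)
    qed (use det_pos[of e] e(1) in auto)
    then show "continuous_on ?S ?H1"
      by (intro continuous_intros)
    fix t :: real and x :: "real^'n^'n"
    assume t: "t \<in> {0..1}" and x: "norm x = 1"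
    have "\<bar>t * e\<bar> \<le> e"
      using t e(1) by (simp add: abs_mult mult_left_le_one_le)
    then have nz: "det (?I + (t * e) *\<^sub>R x) \<noteq> 0"
      using det_pos x by (metis less_irrefl)
    show "?H1 (t, x) \<noteq> 0"
    proof
      assume "?H1 (t, x) = 0"
      then have "H (?I + e *\<^sub>R x) - ?I = 0"
        using matrix_mult_right_cancel[OF _ nz, of "H (?I + e *\<^sub>R x) - ?I" 0] by simp
      then have "H (?I + e *\<^sub>R x) = H ?I"
        by (simp add: H_1)
      then have "?I + e *\<^sub>R x = ?I"
        using inj_onD[OF inj, of "?I + e *\<^sub>R x" ?I] det_pos[of e x] e(1) x by simp
      then show False
        using e(1) x by auto
    qed
  qed
  also have "\<dots> = sphere_degree (\<lambda>x. ((s x)\<^sup>2 - 1) *\<^sub>R ?I - e *\<^sub>R x)"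
  proof (rule sphere_degree_cong)
    fix x :: "real^'n^'n" assume "norm x = 1"
    then have "H (?I + e *\<^sub>R x) ** (?I + e *\<^sub>R x) = (s x)\<^sup>2 *\<^sub>R ?I"
      using H[OF det_pos[of e x]] e(1) by (simp add: s_def)
    then show "?H1 (1, x) = ((s x)\<^sup>2 - 1) *\<^sub>R ?I - e *\<^sub>R x"
      by (simp add: matrix_diff_rdistrib scaleR_diff_left)
  qed

  also have "\<dots> = sphere_degree (\<lambda>x. e *\<^sub>R - (x - (2 * (x \<bullet> u)) *\<^sub>R u))"
  proof -
    \<comment> \<open>Replace \<open>s\<^sup>2 - 1\<close> by its linear part. A zero could only occur at a scalar matrix \<open>x\<close>,
      where \<open>s x\<close> is explicit.\<close>
    let ?H2 = "\<lambda>p. ((1 - fst p) * ((s (snd p))\<^sup>2 - 1)) *\<^sub>R ?I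
                   + (fst p * (2 * e * (snd p \<bullet> u))) *\<^sub>R u - e *\<^sub>R snd p"
    have "sphere_degree (\<lambda>x. ?H2 (0, x)) = sphere_degree (\<lambda>x. ?H2 (1, x))"
    proof (rule sphere_degree_homotopy)
      show "continuous_on ?S ?H2"
        unfolding s_def by (intro continuous_intros)
      fix t :: real and x :: "real^'n^'n"
      assume t: "t \<in> {0..1}" and x: "norm x = 1"
      show "?H2 (t, x) \<noteq> 0"
      proof
        assume eq: "?H2 (t, x) = 0"
        define k where "k = (1 / e) * ((1 - t) * ((s x)\<^sup>2 - 1) + t * (2 * e * (x \<bullet> u)) * (1 / norm ?I))"
        have "e *\<^sub>R x = ((1 - t) * ((s x)\<^sup>2 - 1) + t * (2 * e * (x \<bullet> u)) * (1 / norm ?I)) *\<^sub>R ?I"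
          using eq by (simp add: u_def scaleR_add_left)
        then have "(1 / e) *\<^sub>R e *\<^sub>R x = k *\<^sub>R ?I"
          by (simp only: k_def scaleR_scaleR)
        then have x_k: "x = k *\<^sub>R ?I"
          using e(1) by simp
        have "\<bar>k\<bar> * norm ?I = 1"
          using x by (simp add: x_k)
        then have k: "k \<noteq> 0" "\<bar>k\<bar> \<le> 1"
          using norm_mat_1_ge_1[where 'n='n] mult_left_mono[of 1 "norm ?I" "\<bar>k\<bar>"] by auto
        have ek: "\<bar>e * k\<bar> \<le> 1 / 2"
          using mult_mono[of e "1/2" "\<bar>k\<bar>" 1] e k by (simp add: abs_mult)
        have xu: "(x \<bullet> u) *\<^sub>R u = k *\<^sub>R ?I"
          using norm_I by (simp add: x_k u_def dot_square_norm power2_eq_square)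
        have "?I + e *\<^sub>R x = (1 + e * k) *\<^sub>R ?I"
          by (simp add: x_k scaleR_add_left)
        then have "s x = 1 + e * k"
          using ek by (simp add: s_def det_scaleR real_root_power_cancel)
        \<comment> \<open>For x = k * 1 the coefficient is (1 - t) (2 e k + (e k)^2) + 2 t e k - e
          k. The terms linear in e k add up to e k for every t, so the zero e k = 0 splits
          off.\<close>
        then have "0 = ((1 - t) * ((1 + e * k)\<^sup>2 - 1)) *\<^sub>R ?I + (t * (2 * e)) *\<^sub>R ((x \<bullet> u) *\<^sub>R u) - (e * k) *\<^sub>R ?I"
          using eq x_k by (simp add: mult.assoc)
        also have "\<dots> = ((e * k) * (1 + (1 - t) * (e * k))) *\<^sub>R ?I"
          unfolding xu by (simp add: algebra_simps power2_eq_square flip: scaleR_add_left scaleR_diff_left)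
        finally have "(e * k) * (1 + (1 - t) * (e * k)) = 0"
          using norm_I by auto
        moreover have "\<bar>(1 - t) * (e * k)\<bar> \<le> 1 / 2"
          using mult_mono[of "1 - t" 1 "\<bar>e * k\<bar>" "1 / 2"] t ek by (simp add: abs_mult)
        ultimately show False
          using e(1) k(1) by auto
      qed
    qed
    moreover have "(\<lambda>x. ?H2 (1, x)) = (\<lambda>x. e *\<^sub>R - (x - (2 * (x \<bullet> u)) *\<^sub>R u))"
      by (simp add: fun_eq_iff scaleR_diff_right mult.left_commute mult.assoc)
    ultimately show ?thesis by simp
  qed
  also have "\<dots> = sphere_degree (\<lambda>x. - (x - (2 * (x \<bullet> u)) *\<^sub>R u))"
    by (rule sphere_degree_scaleR[OF e(1)])
  also have "\<dots> = sphere_degree (\<lambda>x. x - (2 * (x \<bullet> u)) *\<^sub>R u)"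
  proof -
    obtain J :: "real^'n^'n" where J: "J ** J = - mat 1"
      using ex_matrix_square_eq_neg_mat_1[OF even] by blast
    \<comment> \<open>The rotation matrix runs from 1 to -1 and stays invertible, so multiplying by
      it maps no nonzero matrix to zero. This removes the minus sign.\<close>
    let ?H3 = "\<lambda>p. (cos (pi * fst p) *\<^sub>R ?I + sin (pi * fst p) *\<^sub>R J) ** - (snd p - (2 * (snd p \<bullet> u)) *\<^sub>R u)"
    have "sphere_degree (\<lambda>x. ?H3 (0, x)) = sphere_degree (\<lambda>x. ?H3 (1, x))"
    proof (rule sphere_degree_homotopy)
      show "continuous_on ?S ?H3"
        by (intro continuous_intros)
      fix t :: real and x :: "real^'n^'n"
      assume "norm x = 1"
      then have "- (x - (2 * (x \<bullet> u)) *\<^sub>R u) \<noteq> 0"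
        using reflection_eq_0_iff[OF norm_u, of x] by auto
      then show "?H3 (t, x) \<noteq> 0"
        using det_rotation_pos[OF J, of "pi * t"]
          matrix_mult_left_cancel[of _ "- (x - (2 * (x \<bullet> u)) *\<^sub>R u)" 0] by fastforce
    qed
    then show ?thesis
      by (simp add: matrix_uminus_left)
  qed
  also have "\<dots> = -1"
  proof (rule sphere_degree_reflection[OF norm_u])
    have "2 \<le> CARD('n)"
      using even by (simp add: dvd_imp_le)
    then have "2 * 1 \<le> CARD('n) * CARD('n)"
      by (intro mult_le_mono) auto
    then show "2 \<le> DIM(real^'n^'n)"
      by simp
  qed
  finally show ?thesis .
qed

section \<open>The homogeneous extension and the contradiction\<close>

lemma no_continuous_inverse_square_root:
  fixes f :: "real^'n^'n \<Rightarrow> real^'n^'n"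
  assumes even: "even CARD('n)"
    and f: "\<And>A. det A = 1 \<Longrightarrow> det (f A) = 1"
    and ff: "\<And>A. det A = 1 \<Longrightarrow> f (f A) ** A = mat 1"
    and cont: "continuous_on {A. det A = 1} f"
  shows False
proof -
  let ?U = "{A :: real^'n^'n. det A > 0}"
  define s where "s = (\<lambda>A :: real^'n^'n. root CARD('n) (det A))"
  \<comment> \<open>The extension of \<open>f\<close> that is homogeneous of degree one for positive scalars.\<close>
  define F where "F = (\<lambda>A. s A *\<^sub>R f ((1 / s A) *\<^sub>R A))"
  have s_pos: "s A > 0" if "det A > 0" for A
    using that by (simp add: s_def)
  have s_pow: "s A ^ CARD('n) = det A" if "det A > 0" for A
    using that by (simp add: s_def)
  have unit: "det ((1 / s A) *\<^sub>R A) = 1" if "det A > 0" for A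
    using that by (simp add: det_scaleR power_divide s_pow)
  \<comment> \<open>\<open>F\<close> preserves determinants and hence the scale \<open>s\<close>.
    The rescaling inside the outer \<open>F\<close> thus undoes that of the inner one, and F (F A)
    is s A times f (f B) for the normalised matrix B.\<close>
  have det_F: "det (F A) = det A" if "det A > 0" for A
    using that by (simp add: F_def det_scaleR s_pow f[OF unit])
  have s_F: "s (F A) = s A" if "det A > 0" for A
    using det_F[OF that] by (simp add: s_def)
  have F_F: "F (F A) ** A = (s A)\<^sup>2 *\<^sub>R mat 1" if "det A > 0" for A
  proof -
    define B where "B = (1 / s A) *\<^sub>R A"
    have A: "A = s A *\<^sub>R B"
      using s_pos[OF that] by (simp add: B_def)
    have "F (F A) = s A *\<^sub>R f (f B)"
      using s_pos[OF that] by (simp add: F_def s_F[OF that, unfolded F_def] B_def)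
    then have "F (F A) ** A = s A *\<^sub>R f (f B) ** (s A *\<^sub>R B)"
      using A by metis
    also have "\<dots> = (s A * s A) *\<^sub>R (f (f B) ** B)"
      by (simp add: matrix_algebra_simps)
    also have "f (f B) ** B = mat 1"
      using ff[OF unit[OF that]] by (simp add: B_def)
    finally show ?thesis
      by (simp add: power2_eq_square)
  qed
  \<comment> \<open>\<open>F A\<close> determines \<open>A\<close>: its scale is that of
    \<open>A\<close>, and \<open>A\<close> is obtained from F (F A) ** A = (s A)^2 * 1 by cancelling
    the invertible factor F (F A).\<close>
  have inj: "inj_on F ?U"
  proof (rule inj_onI)
    fix A B assume AB: "A \<in> ?U" "B \<in> ?U" and eq: "F A = F B"
    have "s A = s B"
      using s_F[of A] s_F[of B] AB eq by simp
    have "det (F (F A)) \<noteq> 0"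
      using AB det_F by simp
    moreover have "F (F A) ** A = F (F A) ** B"
      using F_F[of A] F_F[of B] AB eq \<open>s A = s B\<close> by simp
    ultimately show "A = B"
      by (rule matrix_mult_left_cancel[rotated])
  qed
  have cont_s: "continuous_on ?U s"
    unfolding s_def by (intro continuous_intros)
  have cont_F: "continuous_on ?U F"
    unfolding F_def
  proof (intro continuous_on_scaleR cont_s continuous_on_compose2[OF cont])
    show "continuous_on ?U (\<lambda>A. 1 / s A)"
      using s_pos by (intro continuous_intros cont_s) force
  qed (use unit in \<open>auto intro: continuous_on_id\<close>)
  have F_U: "F ` ?U \<subseteq> ?U"
    using det_F by auto
  have "F (mat 1) = f (mat 1)"
    by (simp add: F_def s_def)
  then have "F (mat 1) = mat 1 \<or> F (mat 1) = - mat 1"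
    using inverse_square_root_mat_1_cases[OF f ff cont] by simp
  then have "path_component ?U (mat 1) (F (mat 1))"
    using path_component_mat_1_neg_mat_1[OF even] path_component_refl[of "mat 1" ?U] by auto
  then have "local_degree ?U (F \<circ> F) (mat 1) = (local_degree ?U F (mat 1))\<^sup>2"
    by (rule local_degree_compose_self[OF cont_F inj open_det_pos F_U])
  moreover have "local_degree ?U (F \<circ> F) (mat 1) = -1"
  proof (rule local_degree_scaled_inverse[OF even])
    show "continuous_on ?U (F \<circ> F)" "inj_on (F \<circ> F) ?U"
      using continuous_on_compose[OF cont_F continuous_on_subset[OF cont_F F_U]]
        comp_inj_on[OF inj inj_on_subset[OF inj F_U]] by simp_all
  qed (simp add: F_F s_def)
  ultimately have "(local_degree ?U F (mat 1))\<^sup>2 = -1"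
    by simp
  then show False
    using zero_le_power2[of "local_degree ?U F (mat 1)"] by linarith
qed

theorem theorem5p7:
  assumes "even CARD('n::finite)"
  shows "\<not> (\<exists>f. inverse_ambiguous (special_linear :: (real ^ 'n ^ 'n) monoid) f \<and>
                continuous_on (carrier special_linear) f)"
proof
  let ?G = "special_linear :: (real ^ 'n ^ 'n) monoid"
  assume "\<exists>f. inverse_ambiguous ?G f \<and> continuous_on (carrier special_linear) f"
  then obtain f where f: "inverse_ambiguous ?G f" and cont: "continuous_on (carrier ?G) f"
    by blast
  have carrier: "carrier ?G = {A. det A = 1}"
    by (simp add: special_linear_def)
  have f_mem: "f \<in> carrier ?G \<rightarrow> carrier ?G"
    using f by (auto simp: inverse_ambiguous_def bij_betw_def)
  have "f (f A) \<otimes>\<^bsub>?G\<^esub> A = \<one>\<^bsub>?G\<^esub>" if "A \<in> carrier ?G" for A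
    using f that inverse_ambiguous_iff[OF group_special_linear f_mem]
    by (simp add: group.l_inv[OF group_special_linear])
  then have "f (f A) ** A = mat 1" if "det A = 1" for A
    using that by (simp add: special_linear_def)
  moreover have "det (f A) = 1" if "det A = 1" for A
    using f_mem that by (auto simp: carrier)
  ultimately show False
    using no_continuous_inverse_square_root[OF assms, of f] cont by (auto simp: carrier)
qed

end
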